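(* For a nonempty word $w=a_1\ldots a_k$ with letters in $\mathbb{N}^*$, put $$m_w=x_1^{a_1-1}\bullet\bigl(x_1^{a_2-1}\bullet(\ldots(x_1^{a_{k-1}-1}\bullet x_1^{a_k-1})\ldots)\bigr)\in\mathbb{K}\langle x_0,x_1\rangle,$$ and say that $w$ is admissible if $a_1,\ldots,a_{k-1}>1$. Let $\mathcal{A}dm$ be the set of admissible words. Then $(m_w)_{w\in\mathcal{A}dm}$ is a basis of $\mathbb{K}\langle x_0,x_1\rangle$.
   Context: $\mathbb{K}$ is a field of characteristic zero; $\mathbb{N}^*$ is the set of positive integers. On $\mathbb{K}\langle x_0,x_1\rangle$ (span of words in $x_0,x_1$, $\emptyset$ being the empty word and $x_1^0=\emptyset$), $\sqcup\!\sqcup$ is the shuffle product, and $\bullet$ is the bilinear (prelie) product determined inductively by: for all words $c,d$, $\emptyset\bullet d=0$, $(x_0c)\bullet d=x_0(c\bullet d)$, $(x_1c)\bullet d=x_1(c\bullet d)+x_0(c\sqcup\!\sqcup d)$. For $k=1$, $m_{a_1}=x_1^{a_1-1}$. *)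

theory Defs
  imports Complex_Main "HOL-Library.Poly_Mapping"
begin

datatype letter = X0 | X1

type_synonym 'k ncpoly = "letter list \<Rightarrow>\<^sub>0 'k"

definition scale :: "'k::field_char_0 \<Rightarrow> 'k ncpoly \<Rightarrow> 'k ncpoly" where
  "scale c p = Poly_Mapping.map ((*) c) p"

lemma lookup_scale [simp]: "Poly_Mapping.lookup (scale c p) u = c * Poly_Mapping.lookup p u"
  unfolding scale_def by (transfer fixing: c) (simp add: when_def)

interpretation ncpoly: vector_space "scale :: 'k::field_char_0 \<Rightarrow> 'k ncpoly \<Rightarrow> 'k ncpoly"
  by unfold_locales
    (auto intro!: poly_mapping_eqI simp: lookup_add algebra_simps)

definition word :: "letter list \<Rightarrow> 'k::field_char_0 ncpoly" where
  "word u = Poly_Mapping.single u 1"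

definition linear_extend ::
    "(letter list \<Rightarrow> 'k ncpoly) \<Rightarrow> 'k::field_char_0 ncpoly \<Rightarrow> 'k ncpoly" where
  "linear_extend f p = (\<Sum>u\<in>Poly_Mapping.keys p. scale (Poly_Mapping.lookup p u) (f u))"

definition bilinear_extend ::
    "(letter list \<Rightarrow> letter list \<Rightarrow> 'k ncpoly)
      \<Rightarrow> 'k::field_char_0 ncpoly \<Rightarrow> 'k ncpoly \<Rightarrow> 'k ncpoly" where
  "bilinear_extend f p q = linear_extend (\<lambda>u. linear_extend (f u) q) p"

definition prepend :: "letter \<Rightarrow> 'k::field_char_0 ncpoly \<Rightarrow> 'k ncpoly" where
  "prepend a = linear_extend (\<lambda>u. word (a # u))"

text \<open>
  Shuffle product of two words, counted with multiplicity (unlike \<^const>\<open>shuffles\<close>,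
  which is a set).
\<close>

fun shuffle_word :: "letter list \<Rightarrow> letter list \<Rightarrow> 'k::field_char_0 ncpoly" where
  "shuffle_word [] d = word d"
| "shuffle_word c [] = word c"
| "shuffle_word (a # c) (b # d) =
     prepend a (shuffle_word c (b # d)) + prepend b (shuffle_word (a # c) d)"

fun prelie_word :: "letter list \<Rightarrow> letter list \<Rightarrow> 'k::field_char_0 ncpoly" where
  "prelie_word [] d = 0"
| "prelie_word (X0 # c) d = prepend X0 (prelie_word c d)"
| "prelie_word (X1 # c) d = prepend X1 (prelie_word c d) + prepend X0 (shuffle_word c d)"

definition prelie :: "'k::field_char_0 ncpoly \<Rightarrow> 'k ncpoly \<Rightarrow> 'k ncpoly" where
  "prelie = bilinear_extend prelie_word"

text \<open>
  Words over the positive integers are lists of type \<^typ>\<open>nat list\<close>; the value at the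
  empty list is junk and never used, as admissible words are nonempty.
\<close>

fun m_word :: "nat list \<Rightarrow> 'k::field_char_0 ncpoly" where
  "m_word [] = 0"
| "m_word [a] = word (replicate (a - 1) X1)"
| "m_word (a # b # w) = prelie (word (replicate (a - 1) X1)) (m_word (b # w))"

definition admissible :: "nat list \<Rightarrow> bool" where
  "admissible w \<longleftrightarrow> w \<noteq> [] \<and> (\<forall>a\<in>set w. a \<ge> 1) \<and> (\<forall>a\<in>set (butlast w). a > 1)"

definition Adm :: "nat list set" where
  "Adm = {w. admissible w}"

end

theory Submission
  imports Defs
begin

text \<open>
  Order the words of each length lexicographically with \<open>X0 < X1\<close>. Unfolding the recursion,
  \<open>X1^(n+1) \<bullet> d\<close> is the sum over \<open>i \<le> n\<close> of \<open>X1^i X0 (X1^(n-i) \<squnion> d)\<close>, so its leading word is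
  \<open>X1^n X0 d\<close>, with coefficient 1. Hence the leading word of \<open>m_word [a\<^sub>1, \<dots>, a\<^sub>k]\<close> is
  \<open>X1^(a\<^sub>1-2) X0 \<dots> X1^(a\<^bsub>k-1\<^esub>-2) X0 X1^(a\<^sub>k-1)\<close>, and every word has this form for exactly one
  admissible index: the family is unitriangular with respect to the basis of words.
\<close>

section \<open>Coefficients of linear extensions\<close>

lemma lookup_word: "Poly_Mapping.lookup (word u) v = (if u = v then 1 else 0)"
  by (simp add: word_def lookup_single when_def)

lemma lookup_linear_extend:
  "Poly_Mapping.lookup (linear_extend f p) v =
    (\<Sum>u\<in>Poly_Mapping.keys p. Poly_Mapping.lookup p u * Poly_Mapping.lookup (f u) v)"
  by (simp add: linear_extend_def lookup_sum)

lemma lookup_linear_extend_nonzeroE: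
  assumes "Poly_Mapping.lookup (linear_extend f p) v \<noteq> 0"
  obtains u where "Poly_Mapping.lookup p u \<noteq> 0" "Poly_Mapping.lookup (f u) v \<noteq> 0"
  using assms unfolding lookup_linear_extend
  by (metis (mono_tags, lifting) mult_eq_0_iff sum.not_neutral_contains_not_neutral)

lemma lookup_prepend:
  "Poly_Mapping.lookup (prepend a p) v =
    (case v of [] \<Rightarrow> 0 | b # u \<Rightarrow> if a = b then Poly_Mapping.lookup p u else 0)"
proof (cases v)
  case (Cons b u)
  have "(\<Sum>x\<in>Poly_Mapping.keys p.
      Poly_Mapping.lookup p x * Poly_Mapping.lookup (word (a # x)) (b # u)) =
    (\<Sum>x\<in>Poly_Mapping.keys p. if x = u then (if a = b then Poly_Mapping.lookup p u else 0) else 0)"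
    by (intro sum.cong) (auto simp: lookup_word)
  also have "\<dots> = (if a = b then Poly_Mapping.lookup p u else 0)"
    by (auto simp: in_keys_iff)
  finally show ?thesis
    by (simp add: Cons prepend_def lookup_linear_extend)
qed (simp add: prepend_def lookup_linear_extend lookup_word)

lemma prelie_word_left: "prelie (word u) q = linear_extend (prelie_word u) q"
  by (simp add: prelie_def bilinear_extend_def linear_extend_def [of _ "word u"])
    (simp add: word_def)

lemma ncpoly_expansion:
  "p = (\<Sum>u\<in>Poly_Mapping.keys p. scale (Poly_Mapping.lookup p u) (word u))"
  by (rule poly_mapping_eqI)
    (simp add: lookup_sum lookup_word if_distrib in_keys_iff cong: if_cong)

section \<open>Words occurring in shuffles and in prelie products with a power of \<open>X1\<close>
  on the left\<close>

lemma length_shuffle_word: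
  "Poly_Mapping.lookup (shuffle_word c d) v \<noteq> 0 \<Longrightarrow> length v = length c + length d"
proof (induction c d arbitrary: v rule: shuffle_word.induct)
  case (3 a c b d)
  then show ?case
    by (cases v) (auto simp: lookup_prepend lookup_add split: if_splits, metis add_0)
qed (auto simp: lookup_word split: if_splits)

text \<open>A word beginning with \<open>X1\<close> receives nothing from the summand prepended with
  \<open>X0\<close>, so each induction step strips one \<open>X1\<close>. In the base case the
  shuffle is that of the empty word with \<open>d\<close>, which is \<open>d\<close> itself.\<close>

lemma prelie_word_power_leading:
  "Poly_Mapping.lookup (prelie_word (replicate (Suc n) X1) d) (replicate n X1 @ X0 # e) =
    (if d = e then 1 else 0)"
  by (induction n) (simp_all add: lookup_prepend lookup_add lookup_word)

text \<open>The index \<open>i\<close> counts the letters \<open>X1\<close> put out before the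
  recursion branches into its shuffle term, which puts out \<open>X0\<close>. The length is
  determined because shuffling adds lengths.\<close>

lemma prelie_word_power_support:
  assumes "Poly_Mapping.lookup (prelie_word (replicate (Suc n) X1) d) v \<noteq> 0"
  shows "length v = Suc n + length d \<and> (\<exists>i\<le>n. \<exists>e. v = replicate i X1 @ X0 # e)"
  using assms
proof (induction n arbitrary: v)
  case 0
  then show ?case
    by (cases v) (auto simp: lookup_prepend lookup_add lookup_word split: if_splits)
next
  case (Suc n)
  from Suc.prems obtain b u where v: "v = b # u"
    by (cases v) (auto simp: lookup_prepend lookup_add)
  show ?case
  proof (cases b)
    case X0
    with Suc.prems have "Poly_Mapping.lookup (shuffle_word (replicate (Suc n) X1) d :: 'a ncpoly) u \<noteq> 0"
      by (simp add: v lookup_prepend lookup_add)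
    then have "length u = Suc n + length d"
      by (auto dest: length_shuffle_word)
    then show ?thesis
      by (auto simp: v X0 intro!: exI [of _ 0])
  next
    case X1
    with Suc.prems have "Poly_Mapping.lookup (prelie_word (replicate (Suc n) X1) d :: 'a ncpoly) u \<noteq> 0"
      by (simp add: v lookup_prepend lookup_add)
    from Suc.IH [OF this] obtain i e
      where "length u = Suc n + length d" "i \<le> n" "u = replicate i X1 @ X0 # e"
      by blast
    then show ?thesis
      by (auto simp: v X1 intro!: exI [of _ "Suc i"])
  qed
qed

section \<open>The order on words\<close>

abbreviation word_less :: "(letter list \<times> letter list) set" where
  "word_less \<equiv> lex {(X0, X1)}"

text \<open>\<open>lex\<close> relates only words of equal length, hence is well-founded. The
  dictionary order on all words is not: \<open>X1\<close>, \<open>X0 X1\<close>,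
  \<open>X0 X0 X1\<close>, ... descends forever.\<close>

lemma wf_word_less: "wf word_less"
  by (intro wf_lex wfI_pf) auto

text \<open>The words agree on their first \<open>i\<close> letters; the next letter is
  \<open>X0\<close> in \<open>u\<close> and \<open>X1\<close> in \<open>v\<close>.\<close>

lemma word_less_power_prefix:
  assumes "i < n" "length u = length v"
    and "u = replicate i X1 @ X0 # e" "v = replicate n X1 @ f"
  shows "(u, v) \<in> word_less"
proof -
  have "v = replicate i X1 @ X1 # replicate (n - Suc i) X1 @ f"
    using assms(1,4)
    by (metis Suc_diff_Suc append_Cons append_assoc le_add_diff_inverse
        less_imp_le replicate_Suc replicate_add)
  then show ?thesis
    using assms(2,3) by (simp add: lex_append_left_iff)
qed

section \<open>The bijection between admissible indices and words\<close>

fun leading_word :: "nat list \<Rightarrow> letter list" where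
  "leading_word [] = []"
| "leading_word [a] = replicate (a - 1) X1"
| "leading_word (a # b # w) = replicate (a - 2) X1 @ X0 # leading_word (b # w)"

text \<open>The inverse of \<open>leading_word\<close> on admissible indices. The empty word is
  \<open>X1^0\<close> and has index \<open>[1]\<close>; a letter \<open>X0\<close> opens a new first
  entry with its least admissible value 2; a letter \<open>X1\<close> raises the first entry by
  one.\<close>

fun word_index :: "letter list \<Rightarrow> nat list" where
  "word_index [] = [1]"
| "word_index (X0 # u) = 2 # word_index u"
| "word_index (X1 # u) = Suc (hd (word_index u)) # tl (word_index u)"

lemma admissible_simps:
  "\<not> admissible []"
  "admissible [a] \<longleftrightarrow> a \<ge> 1"
  "admissible (a # b # w) \<longleftrightarrow> a > 1 \<and> admissible (b # w)"
  by (auto simp: admissible_def)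

lemma word_index_admissible: "admissible (word_index u)"
proof (induction u rule: word_index.induct)
  case (2 u)
  then show ?case
    by (cases "word_index u") (auto simp: admissible_simps)
next
  case (3 u)
  then show ?case
    by (cases "word_index u"; cases "tl (word_index u)") (auto simp: admissible_simps)
qed (simp add: admissible_simps)

text \<open>Admissibility gives \<open>a \<ge> 1\<close>, and \<open>a \<ge> 2\<close> if
  \<open>w\<close> is nonempty, so the truncated subtractions in \<open>leading_word\<close> are
  exact.\<close>

lemma leading_word_Suc:
  assumes "admissible (a # w)"
  shows "leading_word (Suc a # w) = X1 # leading_word (a # w)"
  using assms
  by (cases w; cases a)
    (auto simp: admissible_simps numeral_2_eq_2 Suc_diff_le simp flip: replicate_Suc)

lemma leading_word_word_index: "leading_word (word_index u) = u"
proof (induction u rule: word_index.induct)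
  case (2 u)
  then show ?case
    using word_index_admissible [of u]
    by (cases "word_index u") (auto simp: admissible_simps)
next
  case (3 u)
  then show ?case
    using word_index_admissible [of u] leading_word_Suc
    by (cases "word_index u") (auto simp: admissible_simps)
qed simp

lemma word_index_power_append:
  "word_index (replicate n X1 @ u) = (n + hd (word_index u)) # tl (word_index u)"
proof (induction n)
  case 0
  then show ?case
    using word_index_admissible [of u] by (cases "word_index u") (auto simp: admissible_simps)
qed simp

lemma word_index_leading_word: "admissible w \<Longrightarrow> word_index (leading_word w) = w"
proof (induction w rule: leading_word.induct)
  case (2 a)
  then show ?case
    \<comment> \<open>The empty word contributes the entry 1, so the index is
      \<open>(a - 1) + 1 = a\<close>, as \<open>a \<ge> 1\<close>.\<close>
    using word_index_power_append [of "a - 1" "[]"] by (auto simp: admissible_simps)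
qed (auto simp: admissible_simps word_index_power_append)

section \<open>Leading words of the family\<close>

lemma m_word_unitriangular:
  assumes "admissible w"
  shows "Poly_Mapping.lookup (m_word w :: 'k::field_char_0 ncpoly) (leading_word w) = 1 \<and>
    (\<forall>v. Poly_Mapping.lookup (m_word w :: 'k ncpoly) v \<noteq> 0 \<longrightarrow> v = leading_word w \<or> (v, leading_word w) \<in> word_less)"
  using assms
proof (induction w rule: leading_word.induct)
  case 1
  then show ?case
    by (simp add: admissible_simps)
next
  case (2 a)
  then show ?case
    by (auto simp: lookup_word)
next
  case (3 a b w)
  let ?q = "m_word (b # w) :: 'k ncpoly"
  let ?d = "leading_word (b # w)"
  from 3 have q1: "Poly_Mapping.lookup ?q ?d = 1"
    and q2: "\<And>d. Poly_Mapping.lookup ?q d \<noteq> 0 \<Longrightarrow> d = ?d \<or> (d, ?d) \<in> word_less"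
    by (auto simp: admissible_simps)
  from 3 obtain n where a: "a = Suc (Suc n)"
    by (auto simp: admissible_simps dest: less_imp_Suc_add)
  have m: "m_word (a # b # w) = linear_extend (prelie_word (replicate (Suc n) X1)) ?q"
    by (simp add: a prelie_word_left)
  have l: "leading_word (a # b # w) = replicate n X1 @ X0 # ?d"
    by (simp add: a)
  \<comment> \<open>Among the words \<open>d\<close> of \<open>?q\<close>, only
    \<open>d = ?d\<close> contributes to this coefficient.\<close>
  have "Poly_Mapping.lookup (m_word (a # b # w) :: 'k ncpoly) (replicate n X1 @ X0 # ?d) = 1"
    unfolding m lookup_linear_extend prelie_word_power_leading
    by (simp add: q1 if_distrib in_keys_iff cong: if_cong)
  moreover have "v = replicate n X1 @ X0 # ?d \<or> (v, replicate n X1 @ X0 # ?d) \<in> word_less"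
    if "Poly_Mapping.lookup (m_word (a # b # w) :: 'k ncpoly) v \<noteq> 0" for v
  proof -
    from that [unfolded m] obtain d where d: "Poly_Mapping.lookup ?q d \<noteq> 0"
      and v: "Poly_Mapping.lookup (prelie_word (replicate (Suc n) X1) d :: 'k ncpoly) v \<noteq> 0"
      by (rule lookup_linear_extend_nonzeroE)
    from prelie_word_power_support [OF v] obtain i e
      where len: "length v = Suc n + length d" and i: "i \<le> n" and ve: "v = replicate i X1 @ X0 # e"
      by blast
    \<comment> \<open>Comparable words have equal length, so \<open>v\<close> is as long as the
      expected leading word and \<open>lex\<close> can compare them.\<close>
    have len_d: "length d = length ?d"
      using q2 [OF d] by (auto simp: lex_conv)
    show ?thesis
    \<comment> \<open>If \<open>i = n\<close>, the rest of \<open>v\<close> is \<open>d\<close>, and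
      the comparison reduces to that of \<open>d\<close> with \<open>?d\<close>. If
      \<open>i < n\<close>, the earlier \<open>X0\<close> makes \<open>v\<close> smaller.\<close>
    proof (cases "i = n")
      case True
      with v have "e = d"
        by (auto simp only: ve prelie_word_power_leading split: if_splits)
      with q2 [OF d] True show ?thesis
        by (auto simp: ve lex_append_left_iff)
    next
      case False
      with i len len_d show ?thesis
        by (intro disjI2 word_less_power_prefix [OF _ _ ve refl]) auto
    qed
  qed
  ultimately show ?case
    unfolding l by blast
qed

section \<open>Unitriangular families over a well-founded relation are bases\<close>

lemma unitriangular_basis:
  fixes f :: "letter list \<Rightarrow> 'k::field_char_0 ncpoly"
  assumes r: "wf r"
    and lead: "\<And>u. Poly_Mapping.lookup (f u) u = 1"
    and less: "\<And>u v. Poly_Mapping.lookup (f u) v \<noteq> 0 \<Longrightarrow> v = u \<or> (v, u) \<in> r"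
  shows "inj f" "ncpoly.independent (range f)" "ncpoly.span (range f) = UNIV"
proof -
  have asym: "(u, v) \<in> r \<Longrightarrow> (v, u) \<notin> r" for u v
    using r by (rule wf_not_sym)
  show inj: "inj f"
  proof (rule injI)
    fix u v assume "f u = f v"
    \<comment> \<open>If \<open>u\<close> and \<open>v\<close> differed, each would lie below the
      other, since both occur in the common value.\<close>
    with lead [of u] lead [of v] less [of u v] less [of v u] asym show "u = v"
      by (metis zero_neq_one)
  qed
  show "ncpoly.independent (range f)"
    unfolding ncpoly.dependent_explicit
  proof safe
    fix t c p
    assume t: "finite t" "t \<subseteq> range f" "(\<Sum>p\<in>t. scale (c p) p) = 0"
      and p: "p \<in> t" "c p \<noteq> 0"
    define S where "S = {u. f u \<in> t \<and> c (f u) \<noteq> 0}"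
    have S: "finite S" "S \<noteq> {}"
      using finite_vimageI [OF t(1) inj] t(2) p by (auto simp: S_def vimage_def)
    \<comment> \<open>On the finite set \<open>S\<close> the converse of \<open>r\<close> is
      well-founded too, which provides an \<open>r\<close>-maximal index \<open>u\<close> with
      nonzero coefficient.\<close>
    have "wf ((Restr r S)\<inverse>)"
      using S(1) wf_acyclic [OF r]
      by (intro finite_acyclic_wf_converse) (auto intro: acyclic_subset)
    with S(2) obtain u where u: "u \<in> S" and max: "\<And>v. (v, u) \<in> (Restr r S)\<inverse> \<Longrightarrow> v \<notin> S"
      by (meson wfE_min ex_in_conv)
    have "0 = (\<Sum>p\<in>t. c p * Poly_Mapping.lookup p u)"
      using arg_cong [OF t(3), of "\<lambda>p. Poly_Mapping.lookup p u"] by (simp add: lookup_sum)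
    \<comment> \<open>If \<open>u\<close> occurred in another \<open>f v\<close> with nonzero
      coefficient in the relation, then \<open>(u, v) \<in> r\<close> with \<open>v \<in> S\<close>,
      against maximality.\<close>
    also have "\<dots> = (\<Sum>p\<in>t. if p = f u then c (f u) else 0)"
    proof (rule sum.cong)
      fix p assume p: "p \<in> t"
      with t(2) obtain v where v: "p = f v" by blast
      show "c p * Poly_Mapping.lookup p u = (if p = f u then c (f u) else 0)"
        using less [of v u] max [of v] u p by (auto simp: v lead S_def)
    qed simp
    also have "\<dots> = c (f u)"
      using u t(1) by (simp add: S_def)
    finally show False
      using u by (simp add: S_def)
  qed
  have word_span: "word u \<in> ncpoly.span (range f)" for u
    using r
  proof (induction u rule: wf_induct_rule)
    case (less u)
    let ?K = "Poly_Mapping.keys (f u)"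
    have "f u = (\<Sum>v\<in>?K. scale (Poly_Mapping.lookup (f u) v) (word v))"
      by (rule ncpoly_expansion)
    \<comment> \<open>Since \<open>u\<close> has coefficient 1 in \<open>f u\<close>, the equation
      can be solved for \<open>word u\<close>; all other words of \<open>f u\<close> are smaller and
      covered by the induction hypothesis.\<close>
    also have "\<dots> = word u + (\<Sum>v\<in>?K - {u}. scale (Poly_Mapping.lookup (f u) v) (word v))"
      by (subst sum.remove [of _ u]) (simp_all add: in_keys_iff lead)
    finally have "word u = f u - (\<Sum>v\<in>?K - {u}. scale (Poly_Mapping.lookup (f u) v) (word v))"
      by (metis add_diff_cancel_right')
    also have "\<dots> \<in> ncpoly.span (range f)"
      using less assms(3) [of u]
      by (intro ncpoly.span_diff ncpoly.span_sum ncpoly.span_scale)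
        (auto intro: ncpoly.span_base simp: in_keys_iff)
    finally show ?case .
  qed
  have "p \<in> ncpoly.span (range f)" for p
    by (subst ncpoly_expansion) (intro ncpoly.span_sum ncpoly.span_scale word_span)
  then show "ncpoly.span (range f) = UNIV"
    by blast
qed

theorem corollary31:
  shows "inj_on (m_word :: nat list \<Rightarrow> 'k::field_char_0 ncpoly) Adm
    \<and> ncpoly.independent (m_word ` Adm :: 'k ncpoly set)
    \<and> ncpoly.span (m_word ` Adm) = (UNIV :: 'k ncpoly set)"
proof -
  let ?m = "m_word :: nat list \<Rightarrow> 'k ncpoly"
  \<comment> \<open>Reindexing by words makes \<open>u\<close> the leading word of the member with
    index \<open>u\<close>, as \<open>unitriangular_basis\<close> requires.\<close>
  have Adm: "Adm = range word_index"
    by (auto simp: Adm_def word_index_admissible intro: range_eqI word_index_leading_word [symmetric])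
  have tri: "Poly_Mapping.lookup (?m (word_index u)) u = 1"
    "Poly_Mapping.lookup (?m (word_index u)) v \<noteq> 0 \<Longrightarrow> v = u \<or> (v, u) \<in> word_less" for u v
    using m_word_unitriangular [OF word_index_admissible [of u], where 'k = 'k]
    by (auto simp: leading_word_word_index)
  note basis = unitriangular_basis [of word_less "\<lambda>u. ?m (word_index u)",
    OF wf_word_less tri]
  show ?thesis
    using basis unfolding Adm image_image by (auto simp: inj_on_def)
qed

end
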